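(* Let $L_0>0$, $L_1>0$, $\mu>0$, and let $f:\mathbb{R}^d\to\mathbb{R}$ be a differentiable $\mu$-strongly convex function that is $(L_0,L_1)$-smooth, with minimizer $x^*$ and minimum value $f^*$. Let $x^0\in\mathbb{R}^d$, $R:=\|x^0-x^*\|>0$, and let $N\ge1$ be an integer. Let $(x^k)_{k\ge0}$ be generated by gradient descent $$x^{k+1}=x^k-\eta_k\nabla f(x^k),\qquad \eta_k=\frac{1}{L_0+L_1\|\nabla f(x^k)\|},$$ and put $F_k:=f(x^k)-f^*$. Define $$\rho_1=\frac{1}{4L_1R},\qquad \rho_2=\max\Big\{\frac{\sqrt\mu}{2\sqrt2\,L_1},\frac{1}{4L_1R}\Big\},\qquad \rho_3=\frac{\mu}{2L_0},$$ $$\mathcal{T}_2=\max\Big\{k\in\{0,\dots,N-1\}:\ \|\nabla f(x^k)\|\ge\tfrac{L_0}{L_1}\Big\},\qquad \mathcal{T}_1=\max\Big\{k\in\{0,\dots,N-1\}:\ \|\nabla f(x^k)\|\ge\tfrac{L_0}{L_1}\ \text{and}\ F_k>1\Big\},$$ where the maximum over an empty set is set to be $-1$. Then $$F_N\le(1-\rho_3)^{N-\mathcal{T}_2-1}\,(1-\rho_2)^{\mathcal{T}_2-\mathcal{T}_1}\,(1-\rho_1)^{\mathcal{T}_1+1}\,F_0 .$$ In particular, for an absolute constant $C>0$: (i) if $\mathcal{T}_1=-1$ and $\mathcal{T}_2=N-1$, then $F_N\le C\Big(1-\max\Big\{\frac{\sqrt\mu}{2\sqrt2\,L_1},\frac{1}{4L_1R}\Big\}\Big)^NF_0$;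 (ii) if $\mathcal{T}_1=\mathcal{T}_2=-1$, then $F_N\le C\Big(1-\frac{\mu}{2L_0}\Big)^NF_0$.
   Context: $\|\cdot\|$ is the Euclidean norm on $\mathbb{R}^d$. A differentiable function $f:\mathbb{R}^d\to\mathbb{R}$ is $(L_0,L_1)$-smooth if for all $x,y\in\mathbb{R}^d$ with $\|y-x\|\le \frac{1}{L_1}$ one has $\|\nabla f(y)-\nabla f(x)\|\le (L_0+L_1\|\nabla f(x)\|)\,\|y-x\|$. It is $\mu$-strongly convex if $f(y)\ge f(x)+\langle\nabla f(x),y-x\rangle+\frac{\mu}{2}\|y-x\|^2$ for all $x,y\in\mathbb{R}^d$. *)

theory Defs
  imports Complex_Main "Jordan_Normal_Form.Matrix"
begin

text \<open>
  The Euclidean space of dimension \<open>d\<close> is \<open>carrier_vec d :: real vec set\<close>, with \<open>d\<close> a natural number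
  rather than a type, so that a constant can be quantified before the dimension.
  A function on it is a function \<open>real vec \<Rightarrow> real\<close> of which only the values on
  \<open>carrier_vec d\<close> are ever used.
\<close>

definition vnorm :: "real vec \<Rightarrow> real" where
  "vnorm v = sqrt (v \<bullet> v)"

text \<open>Frechet differentiability at \<open>x\<close>, with the derivative represented by the vector \<open>g\<close>.\<close>

definition has_gradient :: "nat \<Rightarrow> (real vec \<Rightarrow> real) \<Rightarrow> real vec \<Rightarrow> real vec \<Rightarrow> bool" where
  "has_gradient d f x g \<longleftrightarrow> g \<in> carrier_vec d \<and>
     (\<forall>\<epsilon>>0. \<exists>\<delta>>0. \<forall>y\<in>carrier_vec d. vnorm (y - x) < \<delta> \<longrightarrow>
        \<bar>f y - f x - g \<bullet> (y - x)\<bar> \<le> \<epsilon> * vnorm (y - x))"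

definition differentiable_vec :: "nat \<Rightarrow> (real vec \<Rightarrow> real) \<Rightarrow> bool" where
  "differentiable_vec d f \<longleftrightarrow> (\<forall>x\<in>carrier_vec d. \<exists>g. has_gradient d f x g)"

definition grad :: "nat \<Rightarrow> (real vec \<Rightarrow> real) \<Rightarrow> real vec \<Rightarrow> real vec" where
  "grad d f x = (THE g. has_gradient d f x g)"

definition L0_L1_smooth :: "nat \<Rightarrow> real \<Rightarrow> real \<Rightarrow> (real vec \<Rightarrow> real) \<Rightarrow> bool" where
  "L0_L1_smooth d L0 L1 f \<longleftrightarrow> differentiable_vec d f \<and>
     (\<forall>x\<in>carrier_vec d. \<forall>y\<in>carrier_vec d. vnorm (y - x) \<le> 1 / L1 \<longrightarrow>
        vnorm (grad d f y - grad d f x) \<le> (L0 + L1 * vnorm (grad d f x)) * vnorm (y - x))"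

definition strongly_convex :: "nat \<Rightarrow> real \<Rightarrow> (real vec \<Rightarrow> real) \<Rightarrow> bool" where
  "strongly_convex d \<mu> f \<longleftrightarrow> differentiable_vec d f \<and>
     (\<forall>x\<in>carrier_vec d. \<forall>y\<in>carrier_vec d.
        f y \<ge> f x + grad d f x \<bullet> (y - x) + \<mu> / 2 * (vnorm (y - x))\<^sup>2)"

definition is_minimizer :: "nat \<Rightarrow> (real vec \<Rightarrow> real) \<Rightarrow> real vec \<Rightarrow> bool" where
  "is_minimizer d f z \<longleftrightarrow> z \<in> carrier_vec d \<and> (\<forall>y\<in>carrier_vec d. f z \<le> f y)"

text \<open>Step size \<open>\<eta>\<^sub>k = 1 / (L0 + L1 * vnorm (\<nabla>f (x\<^sub>k)))\<close>.\<close>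

definition gradient_descent ::
  "nat \<Rightarrow> real \<Rightarrow> real \<Rightarrow> (real vec \<Rightarrow> real) \<Rightarrow> (nat \<Rightarrow> real vec) \<Rightarrow> bool" where
  "gradient_descent d L0 L1 f x \<longleftrightarrow> x 0 \<in> carrier_vec d \<and>
     (\<forall>k. x (Suc k) =
        x k - (1 / (L0 + L1 * vnorm (grad d f (x k)))) \<cdot>\<^sub>v grad d f (x k))"

text \<open>Only used for finite sets of indices; the value \<open>-1\<close> for the empty set is why it is an integer.\<close>

definition last_index :: "nat set \<Rightarrow> int" where
  "last_index K = (if K = {} then -1 else int (Max K))"

text \<open>The gradient is unique, so the definite description in \<open>grad\<close> is proper wherever
  \<open>f\<close> is differentiable.\<close>

lemma vnorm_smult:
  assumes "v \<in> carrier_vec d"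
  shows "vnorm (t \<cdot>\<^sub>v v) = \<bar>t\<bar> * vnorm v"
proof -
  have "(t \<cdot>\<^sub>v v) \<bullet> (t \<cdot>\<^sub>v v) = t\<^sup>2 * (v \<bullet> v)"
    using assms by (simp add: power2_eq_square)
  then show ?thesis by (simp add: vnorm_def real_sqrt_mult)
qed

lemma scalar_prod_self_nonneg: "(v :: real vec) \<bullet> v \<ge> 0"
  by (auto simp: scalar_prod_def intro: sum_nonneg)

lemma scalar_prod_self_eq_0:
  assumes "(v :: real vec) \<in> carrier_vec d" "v \<bullet> v = 0"
  shows "v = 0\<^sub>v d"
proof (rule eq_vecI)
  show "dim_vec v = dim_vec (0\<^sub>v d)" using assms(1) by simp
  fix i assume "i < dim_vec (0\<^sub>v d :: real vec)"
  moreover have "\<forall>i\<in>{0..<dim_vec v}. v $ i * v $ i = 0"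
    using assms(2) unfolding scalar_prod_def by (subst (asm) sum_nonneg_eq_0_iff) auto
  ultimately show "v $ i = 0\<^sub>v d $ i" using assms(1) by auto
qed

lemma has_gradient_unique:
  assumes x: "x \<in> carrier_vec d" and g: "has_gradient d f x g" and h: "has_gradient d f x h"
  shows "g = h"
proof -
  define w where "w = g - h"
  have gc: "g \<in> carrier_vec d" and hc: "h \<in> carrier_vec d"
    using g h by (auto simp: has_gradient_def)
  then have wc: "w \<in> carrier_vec d" by (simp add: w_def)
  have nn: "vnorm w \<ge> 0" by (simp add: vnorm_def scalar_prod_self_nonneg)
  have sq: "w \<bullet> w = vnorm w * vnorm w" by (simp add: vnorm_def scalar_prod_self_nonneg)
  have "vnorm w = 0"
  proof (rule ccontr)
    assume "vnorm w \<noteq> 0"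
    with nn have pos: "vnorm w > 0" by simp
    define e where "e = vnorm w / 4"
    have e: "e > 0" using pos by (simp add: e_def)
    obtain a where a: "a > 0" "\<forall>y\<in>carrier_vec d. vnorm (y - x) < a \<longrightarrow>
        \<bar>f y - f x - g \<bullet> (y - x)\<bar> \<le> e * vnorm (y - x)"
      using g e unfolding has_gradient_def by blast
    obtain b where b: "b > 0" "\<forall>y\<in>carrier_vec d. vnorm (y - x) < b \<longrightarrow>
        \<bar>f y - f x - h \<bullet> (y - x)\<bar> \<le> e * vnorm (y - x)"
      using h e unfolding has_gradient_def by blast
    define t where "t = min a b / (2 * vnorm w)"
    have t: "t > 0" using a b pos by (simp add: t_def)
    define y where "y = x + t \<cdot>\<^sub>v w"
    have yc: "y \<in> carrier_vec d" using x wc by (simp add: y_def)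
    have yx: "y - x = t \<cdot>\<^sub>v w" using x wc by (intro eq_vecI) (auto simp: y_def)
    have n: "vnorm (y - x) = t * vnorm w" using yx vnorm_smult[OF wc, of t] t by simp
    have "t * vnorm w = min a b / 2" using pos by (simp add: t_def)
    with a(1) b(1) n have "vnorm (y - x) < a" "vnorm (y - x) < b" by auto
    with a(2) b(2) yc have
      "\<bar>f y - f x - g \<bullet> (y - x)\<bar> \<le> e * vnorm (y - x)"
      "\<bar>f y - f x - h \<bullet> (y - x)\<bar> \<le> e * vnorm (y - x)" by blast+
    then have "g \<bullet> (y - x) - h \<bullet> (y - x) \<le> 2 * (e * vnorm (y - x))" by linarith
    moreover have "g \<bullet> (y - x) - h \<bullet> (y - x) = t * (w \<bullet> w)"
      unfolding yx w_def using gc hc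
      by (simp add: minus_scalar_prod_distrib[of _ d] right_diff_distrib)
    ultimately have "t * (vnorm w * vnorm w) \<le> 2 * (e * (t * vnorm w))" by (simp add: sq n)
    also have "\<dots> = t * (vnorm w * vnorm w) / 2" by (simp add: e_def)
    finally show False using t pos by simp
  qed
  then have w0: "w = 0\<^sub>v d" using sq wc scalar_prod_self_eq_0 by simp
  show ?thesis
  proof (rule eq_vecI)
    show "dim_vec g = dim_vec h" using gc hc by simp
    fix i assume i: "i < dim_vec h"
    then have "w $ i = 0" using w0 hc by simp
    then show "g $ i = h $ i" using i by (simp add: w_def)
  qed
qed

lemma grad_eqI: "x \<in> carrier_vec d \<Longrightarrow> has_gradient d f x g \<Longrightarrow> grad d f x = g"
  unfolding grad_def by (blast intro: has_gradient_unique)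

end

theory Submission
  imports Defs
begin

text \<open>
  Write \<open>g\<^sub>k\<close> for the gradient at \<open>x\<^sub>k\<close> and \<open>L\<^sub>k = L0 + L1 * |g\<^sub>k|\<close>. Within distance \<open>1 / L1\<close> of
  \<open>x\<^sub>k\<close> the function lies below its quadratic model with curvature \<open>L\<^sub>k\<close>
  (\<open>L0_L1_smooth_quadratic_bound\<close>), and a gradient step has length \<open>|g\<^sub>k| / L\<^sub>k \<le> 1 / L1\<close>.
  Hence each step decreases \<open>f\<close> by at least \<open>|g\<^sub>k|\<^sup>2 / (2 * L\<^sub>k)\<close> (\<open>gradient_step_decrease\<close>).

  This decrease is a linear contraction of the gap \<open>F\<^sub>k\<close>, for a reason that depends on which term
  dominates \<open>L\<^sub>k\<close>. If \<open>|g\<^sub>k| \<le> L0 / L1\<close>, then \<open>L\<^sub>k \<le> 2 * L0\<close> and the gradient domination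
  inequality \<open>2 * \<mu> * F\<^sub>k \<le> |g\<^sub>k|\<^sup>2\<close> gives the rate \<open>\<rho>3\<close>. If \<open>|g\<^sub>k| \<ge> L0 / L1\<close>, then
  \<open>L\<^sub>k \<le> 2 * L1 * |g\<^sub>k|\<close>, so the decrease is at least \<open>|g\<^sub>k| / (4 * L1)\<close>. Here \<open>|g\<^sub>k|\<close> can be
  bounded below by \<open>F\<^sub>k / R\<close>, from convexity and the fact that the iterates do not move away from
  the minimizer, or by \<open>sqrt (2 * \<mu> * F\<^sub>k)\<close>, which is at least
  \<open>sqrt (2 * \<mu>) * F\<^sub>k\<close> once \<open>F\<^sub>k \<le> 1\<close>.

  It remains to see that the three regimes occur in the order in which the bound lists them: every
  index up to \<open>T2\<close> has a large gradient and every index up to \<open>T1\<close> has moreover a gap above 1.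
  The gap is nonincreasing by the decrease. That the gradient norm is nonincreasing as well
  (\<open>gradient_step_norm_le\<close>) is the crux; it follows from a local form of co-coercivity.
\<close>

section \<open>Euclidean vectors\<close>

lemma vnorm_nonneg: "0 \<le> vnorm v"
  by (simp add: vnorm_def scalar_prod_self_nonneg)

lemma vnorm_power2: "(vnorm v)\<^sup>2 = v \<bullet> v"
  by (simp add: vnorm_def scalar_prod_self_nonneg)

lemma vnorm_eq_0_imp:
  assumes "v \<in> carrier_vec d" "vnorm v = 0"
  shows "v = 0\<^sub>v d"
  using assms scalar_prod_self_eq_0 vnorm_power2[of v] by simp

lemma vnorm_power2_diff:
  assumes "u \<in> carrier_vec d" "v \<in> carrier_vec d"
  shows "(vnorm (u - v))\<^sup>2 = (vnorm u)\<^sup>2 - 2 * (u \<bullet> v) + (vnorm v)\<^sup>2"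
  using assms comm_scalar_prod[of v d u]
  by (simp add: vnorm_power2 minus_scalar_prod_distrib[of _ d] scalar_prod_minus_distrib[of _ d])

lemma vnorm_minus_commute:
  assumes "u \<in> carrier_vec d" "v \<in> carrier_vec d"
  shows "vnorm (u - v) = vnorm (v - u)"
proof -
  have "(vnorm (u - v))\<^sup>2 = (vnorm (v - u))\<^sup>2"
    using assms comm_scalar_prod[of v d u]
    by (simp add: vnorm_power2_diff[of _ d])
  then show ?thesis using vnorm_nonneg power2_eq_imp_eq by blast
qed

lemma vec_Cauchy_Schwarz:
  assumes u: "u \<in> carrier_vec d" and v: "v \<in> carrier_vec d"
  shows "u \<bullet> v \<le> vnorm u * vnorm v"
proof (cases "vnorm u = 0 \<or> vnorm v = 0")
  case True
  then have "u \<bullet> v = 0"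
    using vnorm_eq_0_imp[OF u] vnorm_eq_0_imp[OF v] u v by auto
  then show ?thesis by (simp add: vnorm_nonneg)
next
  case False
  let ?a = "vnorm u" and ?b = "vnorm v"
  have pos: "0 < ?a * ?b" using False vnorm_nonneg[of u] vnorm_nonneg[of v] by simp
  have "0 \<le> (vnorm (?b \<cdot>\<^sub>v u - ?a \<cdot>\<^sub>v v))\<^sup>2" by simp
  also have "\<dots> = (?b * ?a)\<^sup>2 - 2 * (?b * (?a * (u \<bullet> v))) + (?a * ?b)\<^sup>2"
    using u v by (simp add: vnorm_power2_diff[of _ d] vnorm_smult[of _ d] vnorm_nonneg)
  also have "\<dots> = 2 * (?a * ?b) * (?a * ?b - u \<bullet> v)"
    by (simp add: power2_eq_square algebra_simps)
  finally show ?thesis using pos by (simp add: zero_le_mult_iff)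
qed

section \<open>The local quadratic upper bound\<close>

lemma has_gradient_grad:
  assumes "differentiable_vec d f" "x \<in> carrier_vec d"
  shows "has_gradient d f x (grad d f x)"
  using assms grad_eqI unfolding differentiable_vec_def by metis

lemma grad_carrier:
  assumes "differentiable_vec d f" "x \<in> carrier_vec d"
  shows "grad d f x \<in> carrier_vec d"
  using has_gradient_grad[OF assms] by (simp add: has_gradient_def)

lemma has_gradient_imp_line_derivative:
  assumes x: "x \<in> carrier_vec d" and v: "v \<in> carrier_vec d"
    and g: "has_gradient d f (x + t \<cdot>\<^sub>v v) g"
  shows "((\<lambda>s. f (x + s \<cdot>\<^sub>v v)) has_real_derivative g \<bullet> v) (at t)"
  unfolding DERIV_def LIM_eq
proof (intro allI impI)
  fix r :: real assume r: "0 < r"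
  let ?p = "x + t \<cdot>\<^sub>v v"
  have gc: "g \<in> carrier_vec d" using g by (simp add: has_gradient_def)
  (* The added 1 keeps e and the radius below meaningful when v = 0. *)
  define e where "e = (r / 2) / (vnorm v + 1)"
  have n1: "0 < vnorm v + 1" using vnorm_nonneg[of v] by simp
  have e: "0 < e" using r n1 by (simp add: e_def)
  have ev: "e * vnorm v < r"
  proof -
    have "e * vnorm v \<le> e * (vnorm v + 1)" using e by simp
    also have "\<dots> = r / 2" using n1 unfolding e_def by (metis less_irrefl nonzero_eq_divide_eq)
    finally show ?thesis using r by simp
  qed
  obtain a where a: "0 < a" and bound: "\<And>y. y \<in> carrier_vec d \<Longrightarrow> vnorm (y - ?p) < a \<Longrightarrow>
        \<bar>f y - f ?p - g \<bullet> (y - ?p)\<bar> \<le> e * vnorm (y - ?p)"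
    using g e unfolding has_gradient_def by blast
  show "\<exists>s>0. \<forall>h. h \<noteq> 0 \<and> norm (h - 0) < s \<longrightarrow>
      norm ((f (x + (t + h) \<cdot>\<^sub>v v) - f ?p) / h - g \<bullet> v) < r"
  proof (intro exI[of _ "a / (vnorm v + 1)"] conjI allI impI)
    show "0 < a / (vnorm v + 1)" using a n1 by simp
    fix h :: real assume h: "h \<noteq> 0 \<and> norm (h - 0) < a / (vnorm v + 1)"
    let ?y = "x + (t + h) \<cdot>\<^sub>v v"
    have yc: "?y \<in> carrier_vec d" using x v by simp
    have yp: "?y - ?p = h \<cdot>\<^sub>v v"
      using x v by (intro eq_vecI) (auto simp: algebra_simps)
    have n: "vnorm (?y - ?p) = \<bar>h\<bar> * vnorm v" using vnorm_smult[OF v] yp by simp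
    have "\<bar>h\<bar> * vnorm v \<le> \<bar>h\<bar> * (vnorm v + 1)" by (simp add: mult_left_mono)
    also have "\<dots> < a" using h n1 by (simp add: pos_less_divide_eq)
    finally have "\<bar>f ?y - f ?p - g \<bullet> (?y - ?p)\<bar> \<le> e * (\<bar>h\<bar> * vnorm v)"
      using bound[OF yc] n by simp
    then have "\<bar>f ?y - f ?p - h * (g \<bullet> v)\<bar> \<le> e * (\<bar>h\<bar> * vnorm v)"
      using yp gc v by simp
    also have "\<dots> < r * \<bar>h\<bar>" using ev h by (simp add: mult.commute mult.left_commute)
    finally have "\<bar>f ?y - f ?p - h * (g \<bullet> v)\<bar> / \<bar>h\<bar> < r"
      using h by (simp add: pos_divide_less_eq)
    moreover have "(f ?y - f ?p) / h - g \<bullet> v = (f ?y - f ?p - h * (g \<bullet> v)) / h"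
      using h by (simp add: field_simps)
    ultimately show "norm ((f ?y - f ?p) / h - g \<bullet> v) < r" by simp
  qed
qed

text \<open>
  Along the segment from \<open>x\<close> to \<open>y\<close> the derivative of \<open>f\<close> exceeds its initial value by at most
  a linear function of the parameter, by the Cauchy-Schwarz inequality. The smoothness condition is
  only ever applied with the base point \<open>x\<close>, so the gradient norm at \<open>x\<close> alone enters the constant.
\<close>

lemma L0_L1_smooth_quadratic_bound:
  assumes smooth: "L0_L1_smooth d L0 L1 f"
    and x: "x \<in> carrier_vec d" and y: "y \<in> carrier_vec d"
    and close: "vnorm (y - x) \<le> 1 / L1"
  shows "f y \<le> f x + grad d f x \<bullet> (y - x)
           + (L0 + L1 * vnorm (grad d f x)) / 2 * (vnorm (y - x))\<^sup>2"
proof -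
  define v where "v = y - x"
  define g where "g = grad d f x"
  define L where "L = L0 + L1 * vnorm g"
  have vc: "v \<in> carrier_vec d" using x y by (simp add: v_def)
  have diff: "differentiable_vec d f" using smooth by (simp add: L0_L1_smooth_def)
  have gc: "g \<in> carrier_vec d" using grad_carrier[OF diff x] by (simp add: g_def)
  define h where "h = (\<lambda>t. f (x + t \<cdot>\<^sub>v v) - t * (g \<bullet> v) - L / 2 * t\<^sup>2 * (vnorm v)\<^sup>2)"
  have "h 1 \<le> h 0"
  proof (rule DERIV_nonpos_imp_nonincreasing[OF zero_le_one])
    fix t :: real assume t: "0 \<le> t" "t \<le> 1"
    let ?p = "x + t \<cdot>\<^sub>v v"
    let ?D = "grad d f ?p \<bullet> v - g \<bullet> v - L * t * (vnorm v)\<^sup>2"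
    have pc: "?p \<in> carrier_vec d" using x vc by simp
    have gp: "grad d f ?p \<in> carrier_vec d" using grad_carrier[OF diff pc] .
    have n: "vnorm (?p - x) = t * vnorm v"
    proof -
      have "?p - x = t \<cdot>\<^sub>v v" using x vc by (intro eq_vecI) auto
      then show ?thesis using vnorm_smult[OF vc] t by simp
    qed
    have "t * vnorm v \<le> vnorm v" using t vnorm_nonneg[of v] by (simp add: mult_left_le_one_le)
    then have "vnorm (?p - x) \<le> 1 / L1" using n close by (simp add: v_def)
    then have lip: "vnorm (grad d f ?p - g) \<le> L * (t * vnorm v)"
      using smooth x pc n unfolding L0_L1_smooth_def L_def g_def by metis
    have "grad d f ?p \<bullet> v - g \<bullet> v = (grad d f ?p - g) \<bullet> v"
      using gp gc vc by (simp add: minus_scalar_prod_distrib[of _ d])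
    also have "\<dots> \<le> vnorm (grad d f ?p - g) * vnorm v"
      using gp gc vc by (intro vec_Cauchy_Schwarz[of _ d]) auto
    also have "\<dots> \<le> L * (t * vnorm v) * vnorm v"
      using lip vnorm_nonneg by (rule mult_right_mono)
    finally have "?D \<le> 0" by (simp add: power2_eq_square)
    moreover have "(h has_real_derivative ?D) (at t)"
      unfolding h_def
      by (rule has_gradient_imp_line_derivative[OF x vc has_gradient_grad[OF diff pc]]
            derivative_eq_intros refl)+ simp
    ultimately show "\<exists>z. (h has_real_derivative z) (at t) \<and> z \<le> 0" by blast
  qed
  moreover have "x + 1 \<cdot>\<^sub>v v = y" using x y by (intro eq_vecI) (auto simp: v_def)
  moreover have "x + 0 \<cdot>\<^sub>v v = x" using x y by (intro eq_vecI) (auto simp: v_def)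
  ultimately show ?thesis by (simp add: h_def L_def g_def v_def)
qed

section \<open>Contraction over a range of indices\<close>

text \<open>
  The sign condition on \<open>q\<close> is conditional so that the lemma also covers an empty range, where a
  factor belonging to a regime that never occurs may well be negative.
\<close>

lemma contraction_power:
  fixes F :: "nat \<Rightarrow> real"
  assumes "m \<le> n"
    and step: "\<And>k. m \<le> k \<Longrightarrow> k < n \<Longrightarrow> F (Suc k) \<le> q * F k"
    and q: "m < n \<Longrightarrow> 0 \<le> q"
  shows "F n \<le> q ^ (n - m) * F m"
  using \<open>m \<le> n\<close> step q
proof (induction n rule: dec_induct)
  case base
  then show ?case by simp
next
  case (step n)
  have "F (Suc n) \<le> q * F n" using step by simp
  also have "\<dots> \<le> q * (q ^ (n - m) * F m)"
    using step by (intro mult_left_mono) auto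
  finally show ?case using step by (simp add: Suc_diff_le)
qed

lemma last_index_downward_closed:
  assumes "1 \<le> N" and down: "\<And>j k. P k \<Longrightarrow> j \<le> k \<Longrightarrow> P j"
  obtains n where "last_index {k \<in> {0..N - 1}. P k} = int n - 1" "n \<le> N"
    "\<And>k. k < N \<Longrightarrow> P k \<longleftrightarrow> k < n"
proof -
  define K where "K = {k \<in> {0..N - 1}. P k}"
  have mem: "k \<in> K \<longleftrightarrow> k < N \<and> P k" for k using \<open>1 \<le> N\<close> by (auto simp: K_def)
  have fin: "finite K" by (simp add: K_def)
  show thesis
  proof (cases "K = {}")
    case True
    then have "last_index K = int 0 - 1" by (simp add: last_index_def)
    moreover have "P k \<longleftrightarrow> k < 0" if "k < N" for k using True mem that by blast
    ultimately show thesis using that[of 0] by (simp add: K_def)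
  next
    case False
    define m where "m = Max K"
    have m: "m < N" "P m" using Max_in[OF fin False] mem by (simp_all add: m_def)
    have "P k \<longleftrightarrow> k < Suc m" if "k < N" for k
      using that m down[of m k] Max_ge[OF fin, of k] mem by (auto simp: less_Suc_eq_le m_def)
    moreover have "last_index K = int (Suc m) - 1" using False by (simp add: last_index_def m_def)
    moreover have "Suc m \<le> N" using m by simp
    ultimately show thesis using that[of "Suc m"] unfolding K_def by blast
  qed
qed

section \<open>One gradient step\<close>

locale strongly_convex_L0_L1_smooth =
  fixes d :: nat and L0 L1 \<mu> :: real and f :: "real vec \<Rightarrow> real" and xstar :: "real vec"
  assumes L0: "0 < L0" and L1: "0 < L1" and \<mu>: "0 < \<mu>"
    and convex: "strongly_convex d \<mu> f"
    and smooth: "L0_L1_smooth d L0 L1 f"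
    and minimizer: "is_minimizer d f xstar"
begin

abbreviation G :: "real vec \<Rightarrow> real vec" where "G \<equiv> grad d f"

definition L :: "real vec \<Rightarrow> real" where "L x = L0 + L1 * vnorm (G x)"

definition gd_step :: "real vec \<Rightarrow> real vec" where "gd_step x = x - (1 / L x) \<cdot>\<^sub>v G x"

lemma G_carrier: "x \<in> carrier_vec d \<Longrightarrow> G x \<in> carrier_vec d"
  using smooth grad_carrier by (simp add: L0_L1_smooth_def)

lemma xstar_carrier: "xstar \<in> carrier_vec d"
  using minimizer by (simp add: is_minimizer_def)

lemma xstar_le: "x \<in> carrier_vec d \<Longrightarrow> f xstar \<le> f x"
  using minimizer by (simp add: is_minimizer_def)

lemma L_pos: "0 < L x"
  using L0 L1 vnorm_nonneg[of "G x"] by (simp add: L_def add_pos_nonneg)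

lemma gd_step_carrier: "x \<in> carrier_vec d \<Longrightarrow> gd_step x \<in> carrier_vec d"
  using G_carrier by (simp add: gd_step_def)

lemma strong_convexity:
  assumes "x \<in> carrier_vec d" "y \<in> carrier_vec d"
  shows "f x + G x \<bullet> (y - x) + \<mu> / 2 * (vnorm (y - x))\<^sup>2 \<le> f y"
  using convex assms by (simp add: strongly_convex_def)

lemma first_order_convexity:
  assumes "x \<in> carrier_vec d" "y \<in> carrier_vec d"
  shows "f x + G x \<bullet> (y - x) \<le> f y"
proof -
  have "0 \<le> \<mu> / 2 * (vnorm (y - x))\<^sup>2" using \<mu> by simp
  then show ?thesis using strong_convexity[OF assms] by linarith
qed

text \<open>
  The direction \<open>w\<close> is kept arbitrary because two choices are needed: the gradient itself, for the
  decrease, and a difference of gradients, for co-coercivity.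
\<close>

lemma scaled_step_bound:
  assumes x: "x \<in> carrier_vec d" and w: "w \<in> carrier_vec d" and len: "L1 * vnorm w \<le> L x"
  shows "f (x - (1 / L x) \<cdot>\<^sub>v w) \<le> f x - (G x \<bullet> w) / L x + (vnorm w)\<^sup>2 / (2 * L x)"
proof -
  let ?y = "x - (1 / L x) \<cdot>\<^sub>v w"
  have yx: "?y - x = (- 1 / L x) \<cdot>\<^sub>v w" using x w by (intro eq_vecI) auto
  have n: "vnorm (?y - x) = vnorm w / L x"
    unfolding yx using vnorm_smult[OF w] L_pos[of x] by simp
  have "vnorm (?y - x) \<le> 1 / L1"
    using len L1 L_pos[of x] unfolding n by (simp add: field_simps)
  then have "f ?y \<le> f x + G x \<bullet> (?y - x) + L x / 2 * (vnorm (?y - x))\<^sup>2"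
    using L0_L1_smooth_quadratic_bound[OF smooth x, of ?y] x w by (simp add: L_def)
  also have "G x \<bullet> (?y - x) = - (G x \<bullet> w) / L x"
    unfolding yx using G_carrier[OF x] w by simp
  also have "L x / 2 * (vnorm (?y - x))\<^sup>2 = (vnorm w)\<^sup>2 / (2 * L x)"
    unfolding n using L_pos[of x] by (simp add: field_simps power2_eq_square)
  finally show ?thesis by simp
qed

lemma gradient_step_decrease:
  assumes x: "x \<in> carrier_vec d"
  shows "f (gd_step x) \<le> f x - (vnorm (G x))\<^sup>2 / (2 * L x)"
proof -
  have "L1 * vnorm (G x) \<le> L x" using L0 by (simp add: L_def)
  from scaled_step_bound[OF x G_carrier[OF x] this]
  have "f (gd_step x) \<le> f x - (vnorm (G x))\<^sup>2 / L x + (vnorm (G x))\<^sup>2 / (2 * L x)"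
    by (simp add: gd_step_def vnorm_power2)
  then show ?thesis by simp
qed

lemma gap_ge_gradient:
  assumes x: "x \<in> carrier_vec d"
  shows "(vnorm (G x))\<^sup>2 / (2 * L x) \<le> f x - f xstar"
  using gradient_step_decrease[OF x] xstar_le[OF gd_step_carrier[OF x]] by linarith

text \<open>
  The function \<open>z \<mapsto> f z - G y \<bullet> z\<close> is minimal at \<open>y\<close> by convexity, and one step from \<open>x\<close> against
  its gradient \<open>G x - G y\<close> decreases it by at least the amount on the left. That step
  is short enough for the quadratic bound because \<open>x\<close> and \<open>y\<close> are within distance \<open>1 / L1\<close>.
\<close>

lemma local_cocoercivity:
  assumes x: "x \<in> carrier_vec d" and y: "y \<in> carrier_vec d" and close: "vnorm (y - x) \<le> 1 / L1"
  shows "(vnorm (G x - G y))\<^sup>2 / (2 * L x) \<le> f x - f y - G y \<bullet> (x - y)"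
proof -
  define w where "w = G x - G y"
  note gx = G_carrier[OF x] and gy = G_carrier[OF y]
  have w: "w \<in> carrier_vec d" using gx gy by (simp add: w_def)
  let ?z = "x - (1 / L x) \<cdot>\<^sub>v w"
  have "vnorm w \<le> L x * vnorm (y - x)"
    using smooth x y close vnorm_minus_commute[OF gx gy]
    unfolding L0_L1_smooth_def L_def w_def by metis
  also have "\<dots> \<le> L x * (1 / L1)"
    using close L_pos[of x] by (intro mult_left_mono) auto
  finally have "L1 * vnorm w \<le> L x" using L1 by (simp add: field_simps)
  then have "f ?z \<le> f x - (G x \<bullet> w) / L x + (vnorm w)\<^sup>2 / (2 * L x)"
    by (rule scaled_step_bound[OF x w])
  moreover have "f y + G y \<bullet> (?z - y) \<le> f ?z"
    using x y w by (intro first_order_convexity) auto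
  moreover have "G y \<bullet> (?z - y) = G y \<bullet> (x - y) - (G y \<bullet> w) / L x"
  proof -
    have "?z - y = (x - y) - (1 / L x) \<cdot>\<^sub>v w" using x y w by (intro eq_vecI) auto
    then show ?thesis using x y w gy by (simp add: scalar_prod_minus_distrib[of _ d])
  qed
  moreover have "(G x \<bullet> w) / L x - (G y \<bullet> w) / L x = (vnorm w)\<^sup>2 / L x"
  proof -
    have "(vnorm w)\<^sup>2 = G x \<bullet> w - G y \<bullet> w"
      unfolding vnorm_power2 using minus_scalar_prod_distrib[OF gx gy w] by (simp add: w_def)
    then show ?thesis by (simp add: diff_divide_distrib)
  qed
  moreover have "(vnorm w)\<^sup>2 / L x = 2 * ((vnorm w)\<^sup>2 / (2 * L x))" by simp
  ultimately show ?thesis unfolding w_def by linarith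
qed

text \<open>
  Adding convexity at \<open>x\<close> to co-coercivity based at \<open>x\<close> cancels the function values and, as the step
  size is exactly \<open>1 / L x\<close>, leaves \<open>|G x|\<^sup>2 - G y \<bullet> G x \<ge> |G x - G y|\<^sup>2 / 2\<close> for \<open>y = gd_step x\<close>.
  Expanding the square yields the claim.
\<close>

lemma gradient_step_norm_le:
  assumes x: "x \<in> carrier_vec d"
  shows "vnorm (G (gd_step x)) \<le> vnorm (G x)"
proof -
  define y where "y = gd_step x"
  have y: "y \<in> carrier_vec d" using gd_step_carrier[OF x] by (simp add: y_def)
  note gx = G_carrier[OF x] and gy = G_carrier[OF y]
  have yx: "y - x = (- 1 / L x) \<cdot>\<^sub>v G x"
    using x gx by (intro eq_vecI) (auto simp: y_def gd_step_def)
  have xy: "x - y = (1 / L x) \<cdot>\<^sub>v G x"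
    using x gx by (intro eq_vecI) (auto simp: y_def gd_step_def)
  have "vnorm (y - x) = vnorm (G x) / L x"
    unfolding yx using vnorm_smult[OF gx] L_pos[of x] by simp
  also have "\<dots> \<le> 1 / L1"
    using L0 L1 L_pos[of x] by (simp add: field_simps L_def)
  finally have "(vnorm (G x - G y))\<^sup>2 / (2 * L x) \<le> f x - f y - G y \<bullet> (x - y)"
    by (rule local_cocoercivity[OF x y])
  moreover have "f x + G x \<bullet> (y - x) \<le> f y" by (rule first_order_convexity[OF x y])
  moreover have "G y \<bullet> (x - y) = (G y \<bullet> G x) / L x" unfolding xy using gx gy by simp
  moreover have "G x \<bullet> (y - x) = - (vnorm (G x))\<^sup>2 / L x"
    unfolding yx using gx by (simp add: vnorm_power2)
  ultimately have "(vnorm (G x - G y))\<^sup>2 / (2 * L x)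
      \<le> (vnorm (G x))\<^sup>2 / L x - (G y \<bullet> G x) / L x" by linarith
  then have "(vnorm (G x - G y))\<^sup>2 \<le> 2 * ((vnorm (G x))\<^sup>2 - G y \<bullet> G x)"
    using L_pos[of x] by (simp add: field_simps)
  then have "(vnorm (G y))\<^sup>2 \<le> (vnorm (G x))\<^sup>2"
    using vnorm_power2_diff[OF gx gy] comm_scalar_prod[OF gx gy] by simp
  then show ?thesis using vnorm_nonneg power2_le_imp_le unfolding y_def by blast
qed

text \<open>
  The squared distance to \<open>xstar\<close> changes by \<open>- (2 / L x) * (G x \<bullet> (x - xstar)) + |G x|\<^sup>2 / (L x)\<^sup>2\<close>, and convexity
  followed by \<open>gap_ge_gradient\<close> gives \<open>G x \<bullet> (x - xstar) \<ge> |G x|\<^sup>2 / (2 * L x)\<close>, which makes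
  this change nonpositive.
\<close>

lemma gradient_step_distance_le:
  assumes x: "x \<in> carrier_vec d"
  shows "vnorm (gd_step x - xstar) \<le> vnorm (x - xstar)"
proof -
  note gx = G_carrier[OF x] and s = xstar_carrier
  let ?e = "x - xstar"
  have e: "?e \<in> carrier_vec d" using x s by simp
  have "gd_step x - xstar = ?e - (1 / L x) \<cdot>\<^sub>v G x"
    using x s gx by (intro eq_vecI) (auto simp: gd_step_def)
  then have exp: "(vnorm (gd_step x - xstar))\<^sup>2
      = (vnorm ?e)\<^sup>2 - 2 * ((1 / L x) * (G x \<bullet> ?e)) + ((1 / L x) * vnorm (G x))\<^sup>2"
    using e gx comm_scalar_prod[OF gx e] vnorm_smult[OF gx, of "1 / L x"] L_pos[of x]
    by (simp add: vnorm_power2_diff[of _ d])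
  have "f x + G x \<bullet> (xstar - x) \<le> f xstar" by (rule first_order_convexity[OF x s])
  moreover have "G x \<bullet> (xstar - x) = - (G x \<bullet> ?e)"
    using gx x s by (simp add: scalar_prod_minus_distrib[of _ d])
  ultimately have "(vnorm (G x))\<^sup>2 / (2 * L x) \<le> G x \<bullet> ?e"
    using gap_ge_gradient[OF x] by linarith
  then have "2 * (1 / L x) * ((vnorm (G x))\<^sup>2 / (2 * L x)) \<le> 2 * (1 / L x) * (G x \<bullet> ?e)"
    using L_pos[of x] by (intro mult_left_mono) auto
  moreover have "2 * (1 / L x) * ((vnorm (G x))\<^sup>2 / (2 * L x)) = ((1 / L x) * vnorm (G x))\<^sup>2"
    by (simp add: power2_eq_square)
  ultimately have "(vnorm (gd_step x - xstar))\<^sup>2 \<le> (vnorm ?e)\<^sup>2" unfolding exp by simp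
  then show ?thesis using vnorm_nonneg power2_le_imp_le by blast
qed

lemma gap_le_gradient_distance:
  assumes x: "x \<in> carrier_vec d"
  shows "f x - f xstar \<le> vnorm (G x) * vnorm (x - xstar)"
proof -
  note gx = G_carrier[OF x] and s = xstar_carrier
  have "f x + G x \<bullet> (xstar - x) \<le> f xstar" by (rule first_order_convexity[OF x s])
  moreover have "G x \<bullet> (xstar - x) = - (G x \<bullet> (x - xstar))"
    using gx x s by (simp add: scalar_prod_minus_distrib[of _ d])
  moreover have "G x \<bullet> (x - xstar) \<le> vnorm (G x) * vnorm (x - xstar)"
    using gx x s by (intro vec_Cauchy_Schwarz[of _ d]) auto
  ultimately show ?thesis by linarith
qed

text \<open>
  This is the Polyak-Lojasiewicz inequality: minimize the strongly convex lower bound over the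
  distance to \<open>x\<close>.
\<close>

lemma gradient_domination:
  assumes x: "x \<in> carrier_vec d"
  shows "2 * \<mu> * (f x - f xstar) \<le> (vnorm (G x))\<^sup>2"
proof -
  note gx = G_carrier[OF x] and s = xstar_carrier
  let ?r = "vnorm (xstar - x)" and ?g = "vnorm (G x)"
  have "f x + G x \<bullet> (xstar - x) + \<mu> / 2 * ?r\<^sup>2 \<le> f xstar" by (rule strong_convexity[OF x s])
  moreover have "G x \<bullet> (xstar - x) = - (G x \<bullet> (x - xstar))"
    using gx x s by (simp add: scalar_prod_minus_distrib[of _ d])
  moreover have "G x \<bullet> (x - xstar) \<le> ?g * ?r"
    using gx x s vnorm_minus_commute[OF x s] vec_Cauchy_Schwarz[of "G x" d "x - xstar"] by simp
  ultimately have "f x - f xstar \<le> ?g * ?r - \<mu> / 2 * ?r\<^sup>2" by linarith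
  then have "2 * \<mu> * (f x - f xstar) \<le> 2 * \<mu> * (?g * ?r - \<mu> / 2 * ?r\<^sup>2)"
    using \<mu> by (intro mult_left_mono) auto
  also have "\<dots> = ?g\<^sup>2 - (?g - \<mu> * ?r)\<^sup>2"
    by (simp add: power2_eq_square algebra_simps)
  also have "\<dots> \<le> ?g\<^sup>2" by simp
  finally show ?thesis .
qed

text \<open>
  At the minimizer the gradient vanishes, so on a small ball around it \<open>f\<close> is squeezed between
  quadratics of curvature \<open>\<mu>\<close> and \<open>L0\<close>. A second point is needed to compare them: in dimension 0
  the conclusion fails.
\<close>

lemma \<mu>_le_L0:
  assumes x: "x \<in> carrier_vec d" and ne: "0 < vnorm (x - xstar)"
  shows "\<mu> \<le> L0"
proof -
  note s = xstar_carrier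
  have "(vnorm (G xstar))\<^sup>2 / (2 * L xstar) \<le> 0" using gap_ge_gradient[OF s] by simp
  then have g0: "vnorm (G xstar) = 0"
    using L_pos[of xstar] by (simp add: divide_le_0_iff)
  define e where "e = x - xstar"
  have e: "e \<in> carrier_vec d" using x s by (simp add: e_def)
  (* The factor places y at distance exactly 1 / L1, the limit of the smoothness condition. *)
  define y where "y = xstar + (1 / (L1 * vnorm e)) \<cdot>\<^sub>v e"
  have y: "y \<in> carrier_vec d" using s e by (simp add: y_def)
  have "y - xstar = (1 / (L1 * vnorm e)) \<cdot>\<^sub>v e" using s e by (intro eq_vecI) (auto simp: y_def)
  then have n: "vnorm (y - xstar) = 1 / L1"
    using vnorm_smult[OF e] L1 ne by (simp add: e_def)
  have "f y \<le> f xstar + G xstar \<bullet> (y - xstar) + L0 / 2 * (1 / L1)\<^sup>2"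
    using L0_L1_smooth_quadratic_bound[OF smooth s y] g0 n by simp
  moreover have "f xstar + G xstar \<bullet> (y - xstar) + \<mu> / 2 * (1 / L1)\<^sup>2 \<le> f y"
    using strong_convexity[OF s y] n by simp
  ultimately have "\<mu> / 2 * (1 / L1)\<^sup>2 \<le> L0 / 2 * (1 / L1)\<^sup>2" by linarith
  then show ?thesis using L1 by (simp add: mult_le_cancel_right)
qed

section \<open>Contraction of the gap in the three regimes\<close>

lemma contraction_small_gradient:
  assumes x: "x \<in> carrier_vec d" and small: "vnorm (G x) \<le> L0 / L1"
  shows "f (gd_step x) - f xstar \<le> (1 - \<mu> / (2 * L0)) * (f x - f xstar)"
proof -
  let ?g = "vnorm (G x)" and ?F = "f x - f xstar"
  have "L x \<le> 2 * L0" using small L1 by (simp add: L_def field_simps)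
  then have "?g\<^sup>2 / (2 * (2 * L0)) \<le> ?g\<^sup>2 / (2 * L x)"
    using L_pos[of x] by (intro divide_left_mono) auto
  moreover have "2 * \<mu> * ?F / (2 * (2 * L0)) \<le> ?g\<^sup>2 / (2 * (2 * L0))"
    using gradient_domination[OF x] L0 by (intro divide_right_mono) auto
  moreover have "2 * \<mu> * ?F / (2 * (2 * L0)) = \<mu> / (2 * L0) * ?F" by simp
  ultimately have "f (gd_step x) - f xstar \<le> ?F - \<mu> / (2 * L0) * ?F"
    using gradient_step_decrease[OF x] by linarith
  then show ?thesis by (simp add: left_diff_distrib)
qed

lemma large_gradient_decrease:
  assumes x: "x \<in> carrier_vec d" and large: "L0 / L1 \<le> vnorm (G x)"
  shows "f (gd_step x) \<le> f x - vnorm (G x) / (4 * L1)"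
proof -
  let ?g = "vnorm (G x)"
  have g: "0 < ?g" using large L0 L1 by (meson divide_pos_pos less_le_trans)
  have "L x \<le> 2 * (L1 * ?g)" using large L1 by (simp add: L_def field_simps)
  then have "?g\<^sup>2 / (2 * (2 * (L1 * ?g))) \<le> ?g\<^sup>2 / (2 * L x)"
    using L_pos[of x] L1 g by (intro divide_left_mono) auto
  moreover have "?g\<^sup>2 / (2 * (2 * (L1 * ?g))) = ?g / (4 * L1)"
    using g by (simp add: power2_eq_square)
  ultimately show ?thesis using gradient_step_decrease[OF x] by linarith
qed

lemma contraction_large_gradient:
  assumes x: "x \<in> carrier_vec d" and large: "L0 / L1 \<le> vnorm (G x)"
    and R: "vnorm (x - xstar) \<le> R" "0 < R"
  shows "f (gd_step x) - f xstar \<le> (1 - 1 / (4 * L1 * R)) * (f x - f xstar)"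
proof -
  let ?g = "vnorm (G x)" and ?F = "f x - f xstar"
  have "?F \<le> ?g * R"
    using gap_le_gradient_distance[OF x] mult_left_mono[OF R(1) vnorm_nonneg[of "G x"]] by linarith
  then have "?F / (4 * L1 * R) \<le> (?g * R) / (4 * L1 * R)"
    using L1 R by (intro divide_right_mono) auto
  also have "\<dots> = ?g / (4 * L1)" using R by simp
  finally have "f (gd_step x) - f xstar \<le> ?F - ?F / (4 * L1 * R)"
    using large_gradient_decrease[OF x large] by linarith
  then show ?thesis by (simp add: left_diff_distrib)
qed

lemma contraction_large_gradient_small_gap:
  assumes x: "x \<in> carrier_vec d" and large: "L0 / L1 \<le> vnorm (G x)" and gap: "f x - f xstar \<le> 1"
  shows "f (gd_step x) - f xstar \<le> (1 - sqrt \<mu> / (2 * sqrt 2 * L1)) * (f x - f xstar)"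
proof -
  let ?g = "vnorm (G x)" and ?F = "f x - f xstar"
  have F: "0 \<le> ?F" using xstar_le[OF x] by simp
  have "?F\<^sup>2 \<le> ?F" using F gap by (simp add: power2_eq_square mult_left_le)
  then have "2 * \<mu> * ?F\<^sup>2 \<le> 2 * \<mu> * ?F" using \<mu> by simp
  also have "\<dots> \<le> ?g\<^sup>2" by (rule gradient_domination[OF x])
  finally have "(sqrt 2 * sqrt \<mu> * ?F)\<^sup>2 \<le> ?g\<^sup>2" using \<mu> by (simp add: power_mult_distrib)
  then have "sqrt 2 * sqrt \<mu> * ?F \<le> ?g" using vnorm_nonneg power2_le_imp_le by blast
  then have "sqrt 2 * sqrt \<mu> * ?F / (4 * L1) \<le> ?g / (4 * L1)"
    using L1 by (intro divide_right_mono) auto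
  moreover have "sqrt 2 * sqrt \<mu> * ?F / (4 * L1) = sqrt \<mu> / (2 * sqrt 2 * L1) * ?F"
    using L1 by (simp add: field_simps)
  ultimately have "f (gd_step x) - f xstar \<le> ?F - sqrt \<mu> / (2 * sqrt 2 * L1) * ?F"
    using large_gradient_decrease[OF x large] by linarith
  then show ?thesis by (simp add: left_diff_distrib)
qed

section \<open>Gluing the regimes together\<close>

text \<open>
  The natural numbers \<open>a\<close> and \<open>b\<close> stand for \<open>T1 + 1\<close> and \<open>T2 + 1\<close>: as gap and gradient norm are
  nonincreasing, the indices of either kind form an initial segment. A factor of one of the first
  two regimes is nonnegative whenever its regime occurs, because a large gradient forces a positive
  gap; in the last regime the gap may vanish, and \<open>\<mu> \<le> L0\<close> is used instead.
\<close>

theorem gradient_descent_three_regimes: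
  assumes gd: "gradient_descent d L0 L1 f x" and R: "R = vnorm (x 0 - xstar)" "0 < R"
    and F: "F = (\<lambda>k. f (x k) - f xstar)" and N: "1 \<le> N"
  obtains a b :: nat where "a \<le> b" "b \<le> N"
    "last_index {k \<in> {0..N - 1}. L0 / L1 \<le> vnorm (G (x k)) \<and> 1 < F k} = int a - 1"
    "last_index {k \<in> {0..N - 1}. L0 / L1 \<le> vnorm (G (x k))} = int b - 1"
    "F N \<le> (1 - \<mu> / (2 * L0)) ^ (N - b)
           * (1 - max (sqrt \<mu> / (2 * sqrt 2 * L1)) (1 / (4 * L1 * R))) ^ (b - a)
           * (1 - 1 / (4 * L1 * R)) ^ a * F 0"
proof -
  let ?\<rho>1 = "1 / (4 * L1 * R)" and ?\<rho>3 = "\<mu> / (2 * L0)"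
  let ?\<rho>2 = "max (sqrt \<mu> / (2 * sqrt 2 * L1)) ?\<rho>1"
  have step: "x (Suc k) = gd_step (x k)" for k
    using gd by (simp add: gradient_descent_def gd_step_def L_def)
  have xc: "x k \<in> carrier_vec d" for k
  proof (induction k)
    case 0
    then show ?case using gd by (simp add: gradient_descent_def)
  next
    case (Suc k)
    then show ?case using gd_step_carrier step by metis
  qed
  have nonneg: "0 \<le> F k" for k using xstar_le[OF xc] by (simp add: F)
  have F_mono: "F k \<le> F j" if "j \<le> k" for j k
  proof -
    have "F (Suc i) \<le> F i" for i
    proof -
      have "0 \<le> (vnorm (G (x i)))\<^sup>2 / (2 * L (x i))" using L_pos[of "x i"] by simp
      then show ?thesis using gradient_step_decrease[OF xc, of i] by (simp add: F step)
    qed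
    then show ?thesis using that lift_Suc_antimono_le by blast
  qed
  have g_mono: "vnorm (G (x k)) \<le> vnorm (G (x j))" if "j \<le> k" for j k
    using lift_Suc_antimono_le[of "\<lambda>i. vnorm (G (x i))"] gradient_step_norm_le[OF xc] that
    by (simp add: step)
  have dist: "vnorm (x k - xstar) \<le> R" for k
    using lift_Suc_antimono_le[of "\<lambda>i. vnorm (x i - xstar)" 0 k] gradient_step_distance_le[OF xc] R
    by (simp add: step)
  obtain a where a: "last_index {k \<in> {0..N - 1}. L0 / L1 \<le> vnorm (G (x k)) \<and> 1 < F k} = int a - 1"
      "a \<le> N" "\<And>k. k < N \<Longrightarrow> L0 / L1 \<le> vnorm (G (x k)) \<and> 1 < F k \<longleftrightarrow> k < a"
  proof (rule last_index_downward_closed[OF N])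
    fix j k :: nat assume "L0 / L1 \<le> vnorm (G (x k)) \<and> 1 < F k" "j \<le> k"
    then show "L0 / L1 \<le> vnorm (G (x j)) \<and> 1 < F j" using g_mono F_mono by fastforce
  qed (rule that)
  obtain b where b: "last_index {k \<in> {0..N - 1}. L0 / L1 \<le> vnorm (G (x k))} = int b - 1"
      "b \<le> N" "\<And>k. k < N \<Longrightarrow> L0 / L1 \<le> vnorm (G (x k)) \<longleftrightarrow> k < b"
  proof (rule last_index_downward_closed[OF N])
    fix j k :: nat assume "L0 / L1 \<le> vnorm (G (x k))" "j \<le> k"
    then show "L0 / L1 \<le> vnorm (G (x j))" using g_mono by fastforce
  qed (rule that)
  have ab: "a \<le> b"
  proof (rule ccontr)
    assume "\<not> a \<le> b"
    then have "b < a" "b < N" using a(2) by auto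
    then show False using a(3) b(3) by blast
  qed
  have large_pos: "0 < F k" if "k < b" for k
  proof -
    have "L0 / L1 \<le> vnorm (G (x k))" using that b(2) b(3) by simp
    then have "0 < vnorm (G (x k))" using L0 L1 by (meson divide_pos_pos less_le_trans)
    then have "0 < (vnorm (G (x k)))\<^sup>2 / (2 * L (x k))" using L_pos[of "x k"] by simp
    then show ?thesis using gap_ge_gradient[OF xc, of k] by (simp add: F)
  qed
  have factor_nonneg: "0 \<le> q" if "k < b" "F (Suc k) \<le> q * F k" for k q
  proof -
    have "0 \<le> q * F k" using nonneg[of "Suc k"] that by linarith
    then show ?thesis using large_pos[OF that(1)] by (simp add: zero_le_mult_iff)
  qed
  have step1: "F (Suc k) \<le> (1 - ?\<rho>1) * F k" if "k < b" for k
    using contraction_large_gradient[OF xc _ dist R(2), of k] that b(2) b(3)[of k]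
    by (simp add: F step)
  have step2: "F (Suc k) \<le> (1 - ?\<rho>2) * F k" if "a \<le> k" "k < b" for k
  proof -
    have "F (Suc k) \<le> (1 - sqrt \<mu> / (2 * sqrt 2 * L1)) * F k"
      using contraction_large_gradient_small_gap[OF xc, of k] that b(2) b(3)[of k] a(3)[of k]
      by (simp add: F step)
    then show ?thesis using step1[OF that(2)] by (simp add: max_def)
  qed
  have step3: "F (Suc k) \<le> (1 - ?\<rho>3) * F k" if "b \<le> k" "k < N" for k
    using contraction_small_gradient[OF xc, of k] that b(3)[of k]
    by (simp add: F step)
  have q3: "0 \<le> 1 - ?\<rho>3"
    using \<mu>_le_L0[OF xc, of 0] R L0 by (simp add: field_simps)
  have q2: "0 \<le> 1 - ?\<rho>2" if "a < b" using factor_nonneg step2 that by blast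
  have q1: "0 \<le> 1 - ?\<rho>1" if "0 < a" using factor_nonneg step1 that ab by (meson less_le_trans)
  have F1: "F a \<le> (1 - ?\<rho>1) ^ a * F 0"
    using contraction_power[where F = F and m = 0 and n = a] step1 q1 ab by simp
  have F2: "F b \<le> (1 - ?\<rho>2) ^ (b - a) * F a"
    using contraction_power[where F = F and m = a and n = b] step2 q2 ab by blast
  have F3: "F N \<le> (1 - ?\<rho>3) ^ (N - b) * F b"
    using contraction_power[where F = F and m = b and n = N] step3 q3 b(2) by blast
  have p2: "0 \<le> (1 - ?\<rho>2) ^ (b - a)" using q2 ab by (cases "a < b") auto
  have "F b \<le> (1 - ?\<rho>2) ^ (b - a) * ((1 - ?\<rho>1) ^ a * F 0)"
    using F2 mult_left_mono[OF F1 p2] by linarith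
  then have "(1 - ?\<rho>3) ^ (N - b) * F b
      \<le> (1 - ?\<rho>3) ^ (N - b) * ((1 - ?\<rho>2) ^ (b - a) * ((1 - ?\<rho>1) ^ a * F 0))"
    using q3 by (intro mult_left_mono) auto
  with F3 have "F N \<le> (1 - ?\<rho>3) ^ (N - b) * (1 - ?\<rho>2) ^ (b - a) * (1 - ?\<rho>1) ^ a * F 0"
    by (simp add: mult.assoc)
  then show thesis using that ab a b by blast
qed

end

text \<open>
  The two special cases are the main bound with two of the three exponents equal to 0, so the
  absolute constant can be taken to be 1.
\<close>

theorem theorem5p1:
  shows "\<exists>C::real. C > 0 \<and>
    (\<forall>(d::nat) (L0::real) (L1::real) (\<mu>::real) (f :: real vec \<Rightarrow> real) (xstar :: real vec)
       (x :: nat \<Rightarrow> real vec) (N::nat).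
      L0 > 0 \<and> L1 > 0 \<and> \<mu> > 0 \<and>
      strongly_convex d \<mu> f \<and> L0_L1_smooth d L0 L1 f \<and> is_minimizer d f xstar \<and>
      gradient_descent d L0 L1 f x \<and> vnorm (x 0 - xstar) > 0 \<and> N \<ge> 1 \<longrightarrow>
      (let R = vnorm (x 0 - xstar);
           F = (\<lambda>k. f (x k) - f xstar);
           \<rho>1 = 1 / (4 * L1 * R);
           \<rho>2 = max (sqrt \<mu> / (2 * sqrt 2 * L1)) (1 / (4 * L1 * R));
           \<rho>3 = \<mu> / (2 * L0);
           T2 = last_index {k \<in> {0..N - 1}. vnorm (grad d f (x k)) \<ge> L0 / L1};
           T1 = last_index {k \<in> {0..N - 1}. vnorm (grad d f (x k)) \<ge> L0 / L1 \<and> F k > 1}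
       in F N \<le> (1 - \<rho>3) powi (int N - T2 - 1) * (1 - \<rho>2) powi (T2 - T1)
                  * (1 - \<rho>1) powi (T1 + 1) * F 0 \<and>
          (T1 = -1 \<and> T2 = int N - 1 \<longrightarrow>
             F N \<le> C * (1 - max (sqrt \<mu> / (2 * sqrt 2 * L1)) (1 / (4 * L1 * R))) ^ N * F 0) \<and>
          (T1 = -1 \<and> T2 = -1 \<longrightarrow>
             F N \<le> C * (1 - \<mu> / (2 * L0)) ^ N * F 0)))"
proof (intro exI[of _ 1] conjI allI impI)
  fix d :: nat and L0 L1 \<mu> :: real and f :: "real vec \<Rightarrow> real" and xstar :: "real vec"
    and x :: "nat \<Rightarrow> real vec" and N :: nat
  assume asm: "L0 > 0 \<and> L1 > 0 \<and> \<mu> > 0 \<and>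
      strongly_convex d \<mu> f \<and> L0_L1_smooth d L0 L1 f \<and> is_minimizer d f xstar \<and>
      gradient_descent d L0 L1 f x \<and> vnorm (x 0 - xstar) > 0 \<and> N \<ge> 1"
  interpret strongly_convex_L0_L1_smooth d L0 L1 \<mu> f xstar
    using asm by unfold_locales auto
  obtain a b :: nat where ab: "a \<le> b" "b \<le> N"
    and T: "last_index {k \<in> {0..N - 1}. L0 / L1 \<le> vnorm (grad d f (x k)) \<and> 1 < f (x k) - f xstar}
              = int a - 1"
      "last_index {k \<in> {0..N - 1}. L0 / L1 \<le> vnorm (grad d f (x k))} = int b - 1"
    and bound: "f (x N) - f xstar \<le> (1 - \<mu> / (2 * L0)) ^ (N - b)
           * (1 - max (sqrt \<mu> / (2 * sqrt 2 * L1)) (1 / (4 * L1 * vnorm (x 0 - xstar)))) ^ (b - a)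
           * (1 - 1 / (4 * L1 * vnorm (x 0 - xstar))) ^ a * (f (x 0) - f xstar)"
    using gradient_descent_three_regimes[OF _ refl _ refl, of x N] asm by blast
  have powers: "z powi (int N - (int b - 1) - 1) = z ^ (N - b)"
    "z powi (int b - 1 - (int a - 1)) = z ^ (b - a)"
    "z powi (int a - 1 + 1) = z ^ a" for z :: real
  proof -
    have "int N - (int b - 1) - 1 = int (N - b)" "int b - 1 - (int a - 1) = int (b - a)"
      "int a - 1 + 1 = int a"
      using ab by linarith+
    then show "z powi (int N - (int b - 1) - 1) = z ^ (N - b)"
      "z powi (int b - 1 - (int a - 1)) = z ^ (b - a)" "z powi (int a - 1 + 1) = z ^ a"
      by (simp_all only: power_int_of_nat)
  qed
  show "let R = vnorm (x 0 - xstar);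
           F = (\<lambda>k. f (x k) - f xstar);
           \<rho>1 = 1 / (4 * L1 * R);
           \<rho>2 = max (sqrt \<mu> / (2 * sqrt 2 * L1)) (1 / (4 * L1 * R));
           \<rho>3 = \<mu> / (2 * L0);
           T2 = last_index {k \<in> {0..N - 1}. vnorm (grad d f (x k)) \<ge> L0 / L1};
           T1 = last_index {k \<in> {0..N - 1}. vnorm (grad d f (x k)) \<ge> L0 / L1 \<and> F k > 1}
       in F N \<le> (1 - \<rho>3) powi (int N - T2 - 1) * (1 - \<rho>2) powi (T2 - T1)
                  * (1 - \<rho>1) powi (T1 + 1) * F 0 \<and>
          (T1 = -1 \<and> T2 = int N - 1 \<longrightarrow>
             F N \<le> 1 * (1 - max (sqrt \<mu> / (2 * sqrt 2 * L1)) (1 / (4 * L1 * R))) ^ N * F 0) \<and>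
          (T1 = -1 \<and> T2 = -1 \<longrightarrow>
             F N \<le> 1 * (1 - \<mu> / (2 * L0)) ^ N * F 0)"
    unfolding Let_def T powers
  proof (intro conjI impI, goal_cases)
    case 1
    show ?case by (rule bound)
  next
    case 2
    then have "a = 0" "b = N" by simp_all
    then show ?case using bound by simp
  next
    case 3
    then have "a = 0" "b = 0" by simp_all
    then show ?case using bound by simp
  qed
qed simp

end
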